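(* Let $X$ be an extremally disconnected regular Hausdorff space, $Y$ be a regular Hausdorff space, and $\varphi$ be an usco mapping from $X$ to the nonempty subsets of $Y$. Then for every dense subset $A\subset X$ and every continuous map $g:A\to Y$ with $g(x)\in\varphi(x)$ for all $x\in A$, there exists a continuous map $f:X\to Y$ such that $f(x)\in\varphi(x)$ for all $x\in X$ and $f(x)=g(x)$ for all $x\in A$.
   Context: A space $X$ is extremally disconnected if $\overline{U}$ is open for every open $U\subset X$. A mapping $\varphi$ assigning to each $x\in X$ a nonempty subset $\varphi(x)\subset Y$ is upper semi-continuous (u.s.c.) if $\{x\in X:\varphi(x)\cap F\neq\varnothing\}$ is closed in $X$ for every closed $F\subset Y$; it is usco if it is u.s.c. and every $\varphi(x)$, $x\in X$, is compact. The subset $A\subset X$ carries the subspace topology. *)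

theory Defs
  imports "HOL-Analysis.Analysis"
begin

definition extremally_disconnected_space :: "'a topology \<Rightarrow> bool" where
  "extremally_disconnected_space X \<longleftrightarrow>
     (\<forall>U. openin X U \<longrightarrow> openin X (X closure_of U))"

text \<open>
  A set-valued mapping on \<open>X\<close> is represented by a function \<open>\<phi>\<close> of which only the values
  on \<open>topspace X\<close> matter.
\<close>

definition nonempty_valued_map :: "'a topology \<Rightarrow> 'b topology \<Rightarrow> ('a \<Rightarrow> 'b set) \<Rightarrow> bool" where
  "nonempty_valued_map X Y \<phi> \<longleftrightarrow>
     (\<forall>x \<in> topspace X. \<phi> x \<noteq> {} \<and> \<phi> x \<subseteq> topspace Y)"

definition usc_map :: "'a topology \<Rightarrow> 'b topology \<Rightarrow> ('a \<Rightarrow> 'b set) \<Rightarrow> bool" where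
  "usc_map X Y \<phi> \<longleftrightarrow>
     nonempty_valued_map X Y \<phi> \<and>
     (\<forall>F. closedin Y F \<longrightarrow> closedin X {x \<in> topspace X. \<phi> x \<inter> F \<noteq> {}})"

definition usco_map :: "'a topology \<Rightarrow> 'b topology \<Rightarrow> ('a \<Rightarrow> 'b set) \<Rightarrow> bool" where
  "usco_map X Y \<phi> \<longleftrightarrow>
     usc_map X Y \<phi> \<and> (\<forall>x \<in> topspace X. compactin Y (\<phi> x))"

end

theory Submission
  imports Defs
begin

text \<open>
  Let \<open>f x\<close> be a cluster value at \<open>x\<close> of \<open>g\<close> lying in \<open>\<phi> x\<close>; one exists by compactness of
  \<open>\<phi> x\<close> and upper semi-continuity, and for \<open>x \<in> A\<close> one may take \<open>g x\<close>. Extremal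
  disconnectedness makes the closure \<open>U\<close> of \<open>{a \<in> A. g a \<in> V}\<close> open for every open \<open>V\<close>,
  and continuity of \<open>g\<close> on \<open>A\<close> gives \<open>g a \<in> Y closure_of V\<close> for all \<open>a \<in> A \<inter> U\<close>. So every
  cluster value at a point of \<open>U\<close> lies in the closure of \<open>V\<close>, and regularity of \<open>Y\<close> shows
  that \<open>f\<close> is continuous.
\<close>

text \<open>Equivalently, \<open>(x, y)\<close> lies in the closure of the graph of \<open>g\<close>
  over \<open>A\<close> in the product of \<open>X\<close> and \<open>Y\<close>.\<close>

definition cluster_value ::
    "'a topology \<Rightarrow> 'b topology \<Rightarrow> 'a set \<Rightarrow> ('a \<Rightarrow> 'b) \<Rightarrow> 'a \<Rightarrow> 'b \<Rightarrow> bool" where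
  "cluster_value X Y A g x y \<longleftrightarrow>
     y \<in> topspace Y \<and> (\<forall>V. openin Y V \<and> y \<in> V \<longrightarrow> x \<in> X closure_of {a \<in> A. g a \<in> V})"

text \<open>Upper semi-continuity in its open form, which lets a cover of \<open>\<phi> x\<close>
  persist for all values near \<open>x\<close>.\<close>

lemma openin_usc_upper_preimage:
  assumes "usc_map X Y \<phi>" and "openin Y V"
  shows "openin X {x \<in> topspace X. \<phi> x \<subseteq> V}"
proof -
  have "closedin X {x \<in> topspace X. \<phi> x \<inter> (topspace Y - V) \<noteq> {}}"
    using assms unfolding usc_map_def by blast
  moreover have "{x \<in> topspace X. \<phi> x \<subseteq> V} =
      topspace X - {x \<in> topspace X. \<phi> x \<inter> (topspace Y - V) \<noteq> {}}"
    using assms(1) unfolding usc_map_def nonempty_valued_map_def by blast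
  ultimately show ?thesis by (simp add: openin_diff)
qed

lemma usco_map_cluster_value:
  assumes usco: "usco_map X Y \<phi>"
    and sel: "\<And>a. a \<in> A \<Longrightarrow> g a \<in> \<phi> a"
    and x: "x \<in> X closure_of A"
  shows "\<exists>y \<in> \<phi> x. cluster_value X Y A g x y"
proof (rule ccontr)
  assume no_cluster: "\<not> ?thesis"
  have xX: "x \<in> topspace X"
    using x by (simp add: in_closure_of)
  have "\<phi> x \<subseteq> topspace Y"
    using usco xX unfolding usco_map_def usc_map_def nonempty_valued_map_def by blast
  with no_cluster have
    "\<forall>y \<in> \<phi> x. \<exists>V. openin Y V \<and> y \<in> V \<and> x \<notin> X closure_of {a \<in> A. g a \<in> V}"
    unfolding cluster_value_def by blast
  \<comment> \<open>Without a cluster value in \<open>\<phi> x\<close>, the open sets whose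
    \<open>g\<close>-preimage stays away from \<open>x\<close> cover
    \<open>\<phi> x\<close>.\<close>
  then have "\<phi> x \<subseteq> \<Union>{V. openin Y V \<and> x \<notin> X closure_of {a \<in> A. g a \<in> V}}"
    by blast
  moreover have "compactin Y (\<phi> x)"
    using usco xX unfolding usco_map_def by blast
  ultimately obtain \<F> where "finite \<F>" and cover: "\<phi> x \<subseteq> \<Union>\<F>"
    and \<F>: "\<F> \<subseteq> {V. openin Y V \<and> x \<notin> X closure_of {a \<in> A. g a \<in> V}}"
    unfolding compactin_def by (metis (no_types, lifting) mem_Collect_eq)
  \<comment> \<open>On this neighbourhood of \<open>x\<close> the finite subcover still contains the
    values of \<open>\<phi>\<close>, hence those of \<open>g\<close> on
    \<open>W \<inter> A\<close>.\<close>
  define W where "W = {z \<in> topspace X. \<phi> z \<subseteq> \<Union>\<F>}"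
  have "openin Y (\<Union>\<F>)"
    using \<F> by blast
  then have "openin X W"
    using usco unfolding W_def usco_map_def by (blast intro: openin_usc_upper_preimage)
  moreover have "x \<in> W"
    using cover xX by (simp add: W_def)
  ultimately have "x \<in> X closure_of (W \<inter> A)"
    using x openin_Int_closure_of_subset by fastforce
  also have "X closure_of (W \<inter> A) \<subseteq> X closure_of (\<Union>V\<in>\<F>. {a \<in> A. g a \<in> V})"
    using sel by (intro closure_of_mono) (auto simp: W_def)
  \<comment> \<open>Closure commutes with this union because \<open>\<F>\<close> is finite; so
    \<open>x\<close> falls into one of the closures that the choice of \<open>\<F>\<close>
    excludes.\<close>
  also have "\<dots> = (\<Union>V\<in>\<F>. X closure_of {a \<in> A. g a \<in> V})"
    using \<open>finite \<F>\<close> by (simp add: closure_of_Union image_image)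
  finally show False
    using \<F> by blast
qed

lemma cluster_value_self:
  assumes "A \<subseteq> topspace X" and "continuous_map (subtopology X A) Y g" and "x \<in> A"
  shows "cluster_value X Y A g x (g x)"
proof -
  have "g x \<in> topspace Y"
    using assms by (auto simp: continuous_map_def)
  moreover have "x \<in> X closure_of {a \<in> A. g a \<in> V}" if "g x \<in> V" for V
    using closure_of_subset[of "{a \<in> A. g a \<in> V}" X] assms that by blast
  ultimately show ?thesis
    by (simp add: cluster_value_def)
qed

text \<open>For a subset of \<open>A\<close>, the closure inside \<open>A\<close> is the trace on
  \<open>A\<close> of the closure in \<open>X\<close>, and a continuous map sends closures into
  closures.\<close>

lemma continuous_map_into_closure_of:
  assumes "continuous_map (subtopology X A) Y g"
    and "a \<in> A" and "a \<in> X closure_of {b \<in> A. g b \<in> V}"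
  shows "g a \<in> Y closure_of V"
proof -
  have "a \<in> subtopology X A closure_of {b \<in> A. g b \<in> V}"
    using assms by (simp add: closure_of_subtopology_subset closure_of_subtopology Int_absorb1)
  then have "g a \<in> Y closure_of (g ` {b \<in> A. g b \<in> V})"
    using continuous_map_image_closure_subset[OF assms(1)] by blast
  moreover have "g ` {b \<in> A. g b \<in> V} \<subseteq> V"
    by blast
  ultimately show ?thesis
    using closure_of_mono by blast
qed

text \<open>The preimage is the trace on \<open>A\<close> of an open set of \<open>X\<close>, and by
  density the trace has the same closure as that open set.\<close>

lemma openin_closure_of_preimage:
  assumes "extremally_disconnected_space X" and "X closure_of A = topspace X"
    and "A \<subseteq> topspace X" and "continuous_map (subtopology X A) Y g" and "openin Y V"
  shows "openin X (X closure_of {a \<in> A. g a \<in> V})"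
proof -
  have "openin (subtopology X A) {a \<in> topspace (subtopology X A). g a \<in> V}"
    using assms(4,5) by (rule openin_continuous_map_preimage)
  then have "openin (subtopology X A) {a \<in> A. g a \<in> V}"
    using assms(3) by (simp add: Int_absorb1)
  then obtain U where U: "openin X U" and eq: "{a \<in> A. g a \<in> V} = U \<inter> A"
    by (auto simp: openin_subtopology)
  have "X closure_of (U \<inter> A) = X closure_of U"
    using closure_of_openin_Int_closure_of[OF U, of A] assms(2) openin_subset[OF U]
    by (simp add: Int_absorb2)
  with U eq assms(1) show ?thesis
    by (simp add: extremally_disconnected_space_def)
qed

text \<open>Any choice of cluster values is continuous, so the choice can be made point by
  point.\<close>

lemma continuous_map_cluster_value:
  assumes ext: "extremally_disconnected_space X" and reg: "regular_space Y"
    and dense: "X closure_of A = topspace X" and A: "A \<subseteq> topspace X"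
    and g: "continuous_map (subtopology X A) Y g"
    and f: "\<And>x. x \<in> topspace X \<Longrightarrow> cluster_value X Y A g x (f x)"
  shows "continuous_map X Y f"
  unfolding continuous_map_eq_topcontinuous_at topcontinuous_at_def
proof (intro ballI conjI allI impI)
  fix x assume x: "x \<in> topspace X"
  then show "x \<in> topspace X" .
  show "f \<in> topspace X \<rightarrow> topspace Y"
    using f by (auto simp: cluster_value_def)
  fix V assume V: "openin Y V \<and> f x \<in> V"
  \<comment> \<open>Regularity shrinks \<open>V\<close> to \<open>V'\<close> with closure still
    inside \<open>V\<close>, since control over \<open>f\<close> near \<open>x\<close> is only up to
    closure.\<close>
  then obtain V' C where V': "openin Y V'" "f x \<in> V'" and "closedin Y C" "V' \<subseteq> C" "C \<subseteq> V"
    using reg unfolding neighbourhood_base_of_closedin[symmetric] neighbourhood_base_of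
    by metis
  then have closure_V': "Y closure_of V' \<subseteq> V"
    using closure_of_minimal by blast
  define U where "U = X closure_of {a \<in> A. g a \<in> V'}"
  have U: "openin X U"
    unfolding U_def using openin_closure_of_preimage ext dense A g V'(1) .
  moreover have "x \<in> U"
    using f[OF x] V' by (simp add: U_def cluster_value_def)
  moreover have "f z \<in> V" if "z \<in> U" for z
  proof (rule ccontr)
    assume "f z \<notin> V"
    have z: "z \<in> topspace X"
      using U that openin_subset by blast
    let ?N = "topspace Y - Y closure_of V'"
    have "openin Y ?N"
      by (simp add: openin_diff)
    moreover have "f z \<in> ?N"
      using f[OF z] \<open>f z \<notin> V\<close> closure_V' by (auto simp: cluster_value_def)
    ultimately have "z \<in> X closure_of {a \<in> A. g a \<in> ?N}"
      using f[OF z] unfolding cluster_value_def by blast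
    \<comment> \<open>As \<open>U\<close> is an open neighbourhood of \<open>z\<close>, it meets the
      preimage of \<open>?N\<close>; but points of \<open>A \<inter> U\<close> are sent into
      \<open>Y closure_of V'\<close>.\<close>
    with U that obtain a where "a \<in> A" "a \<in> U" "g a \<in> ?N"
      unfolding in_closure_of[of z] by blast
    moreover from this have "g a \<in> Y closure_of V'"
      using continuous_map_into_closure_of[OF g] by (simp add: U_def)
    ultimately show False
      by blast
  qed
  ultimately show "\<exists>U. openin X U \<and> x \<in> U \<and> (\<forall>z \<in> U. f z \<in> V)"
    by blast
qed

theorem corollary3p3:
  fixes X :: "'a topology" and Y :: "'b topology" and \<phi> :: "'a \<Rightarrow> 'b set"
  assumes "extremally_disconnected_space X" and "regular_space X" and "Hausdorff_space X"
    and "regular_space Y" and "Hausdorff_space Y"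
    and "usco_map X Y \<phi>"
  shows "\<forall>A g. A \<subseteq> topspace X \<and> X closure_of A = topspace X \<and>
           continuous_map (subtopology X A) Y g \<and> (\<forall>x \<in> A. g x \<in> \<phi> x) \<longrightarrow>
           (\<exists>f. continuous_map X Y f \<and> (\<forall>x \<in> topspace X. f x \<in> \<phi> x) \<and> (\<forall>x \<in> A. f x = g x))"
proof (intro allI impI, elim conjE)
  fix A g
  assume A: "A \<subseteq> topspace X" and dense: "X closure_of A = topspace X"
    and g: "continuous_map (subtopology X A) Y g" and sel: "\<forall>x \<in> A. g x \<in> \<phi> x"
  \<comment> \<open>The last conjunct fixes the choice on \<open>A\<close>, so that the resulting
    map extends \<open>g\<close>.\<close>
  have "\<forall>x \<in> topspace X. \<exists>y. y \<in> \<phi> x \<and> cluster_value X Y A g x y \<and> (x \<in> A \<longrightarrow> y = g x)"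
  proof
    fix x assume x: "x \<in> topspace X"
    show "\<exists>y. y \<in> \<phi> x \<and> cluster_value X Y A g x y \<and> (x \<in> A \<longrightarrow> y = g x)"
    proof (cases "x \<in> A")
      case True
      then show ?thesis
        using cluster_value_self[OF A g] sel by blast
    next
      case False
      then show ?thesis
        using usco_map_cluster_value[OF assms(6), of A g x] sel dense x by blast
    qed
  qed
  then obtain f where f: "\<forall>x \<in> topspace X.
      f x \<in> \<phi> x \<and> cluster_value X Y A g x (f x) \<and> (x \<in> A \<longrightarrow> f x = g x)"
    by metis
  then have "continuous_map X Y f"
    using continuous_map_cluster_value[OF assms(1,4) dense A g] by blast
  with f A show "\<exists>f. continuous_map X Y f \<and> (\<forall>x \<in> topspace X. f x \<in> \<phi> x) \<and>
      (\<forall>x \<in> A. f x = g x)"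
    by blast
qed

end
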